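(* Let $X$ be a complex Hilbert space and let $T\in LR(X)$ have domain $D(T)$ dense in $X$. Then: (i) $T$ is bounded if and only if $\tilde C(T)<\infty$ and $\|T\|\le 2\,\tilde C(T)$; (ii) $T$ is bounded if and only if $\hat C(T)<\infty$ and $\|T\|\le 2\,\hat C(T)$; (iii) in the case that $T$ is closed, $T$ is bounded if and only if $C(T)<\infty$ and $\|T\|\le 2\,C(T)$.
   Context: $LR(X)$ is the set of all linear subspaces of $X\times X$. For $T\in LR(X)$: $D(T)$ is its domain, $T(x)=\{y:(x,y)\in T\}$. A (single-valued) linear operator is identified with its graph. For $X$ Hilbert and $T\in LR(X)$: the quotient $X/\overline{T(0)}$, with classes $[x]=x+\overline{T(0)}$, is a Hilbert space with inner product $\langle[x],[y]\rangle=\langle x^\perp,y^\perp\rangle$, where $x=x_0+x^\perp$, $y=y_0+y^\perp$ with $x_0,y_0\in\overline{T(0)}$ and $x^\perp,y^\perp\in\overline{T(0)}^\perp$ (its norm is the usual quotient norm). $\tilde T_s$ is the linear operator from $D(T)$ to $X/\overline{T(0)}$ given by $\tilde T_s(x)=[y]$ for any $y\in T(x)$. $\hat T_s$ is the linear operator from $D(T)$ to $X$ given by $\hat T_s(x)=P_Ty$ for any $y\in T(x)$, where $P_T:X\to\overline{T(0)}^\perp$ is the orthogonal projection. If $T$ is closed in $X\times X$ (with inner product $\langle(x_1,y_1),(x_2,y_2)\rangle=\langle x_1,x_2\rangle+\langle y_1,y_2\rangle$), $T_\infty:=\{(0,g)\in X^2:(0,g)\in T\}$ and $T_s:=T\ominus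 T_\infty$ (orthogonal complement of $T_\infty$ in $T$), a linear operator with domain $D(T)$. $\|T\|:=\|\tilde T_s\|=\sup\{\|\tilde T_s(x)\|:x\in D(T),\ \|x\|\le1\}$; $T$ is bounded if $\|T\|<\infty$. Define (values in $[0,\infty]$) $$\tilde C(T)=\sup\{|\langle[x],\tilde T_s(x)\rangle|:x\in D(T),\ \|x\|\le1\},$$ $$\hat C(T)=\sup\{|\langle x,\hat T_s(x)\rangle|:x\in D(T),\ \|x\|\le1\},$$ and, for $T$ closed, $$C(T)=\sup\{|\langle x,T_s(x)\rangle|:x\in D(T),\ \|x\|\le1\}.$$ *)

theory Defs
  imports "HOL-Analysis.Analysis"
begin

class complex_vector = real_vector +
  fixes scaleC :: "complex \<Rightarrow> 'a \<Rightarrow> 'a"  (infixr \<open>*\<^sub>C\<close> 75)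
  assumes scaleC_add_right: "c *\<^sub>C (x + y) = c *\<^sub>C x + c *\<^sub>C y"
    and scaleC_add_left: "(c + d) *\<^sub>C x = c *\<^sub>C x + d *\<^sub>C x"
    and scaleC_scaleC: "c *\<^sub>C d *\<^sub>C x = (c * d) *\<^sub>C x"
    and scaleR_scaleC: "r *\<^sub>R x = complex_of_real r *\<^sub>C x"

lemma scaleC_one: "1 *\<^sub>C x = (x :: 'a::complex_vector)"
  using scaleR_scaleC[of 1 x] by simp

global_interpretation complex_vector: vector_space "scaleC :: complex \<Rightarrow> 'a \<Rightarrow> 'a::complex_vector"
  by unfold_locales
    (simp_all add: scaleC_add_right scaleC_add_left scaleC_scaleC scaleC_one)

text \<open>The inner product is linear in its first argument. Positive definiteness is part of
  the last axiom, since the norm of a \<^class>\<open>real_normed_vector\<close> is positive definite.\<close>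

class complex_inner = complex_vector + real_normed_vector +
  fixes cinner :: "'a \<Rightarrow> 'a \<Rightarrow> complex"
  assumes cinner_commute: "cinner x y = cnj (cinner y x)"
    and cinner_add_left: "cinner (x + y) z = cinner x z + cinner y z"
    and cinner_scaleC_left: "cinner (c *\<^sub>C x) y = c * cinner x y"
    and cinner_self: "cinner x x = complex_of_real ((norm x)\<^sup>2)"

class chilbert_space = complex_inner + complete_space

instantiation prod :: (complex_vector, complex_vector) complex_vector
begin

definition scaleC_prod :: "complex \<Rightarrow> 'a \<times> 'b \<Rightarrow> 'a \<times> 'b"
  where "c *\<^sub>C p = (c *\<^sub>C fst p, c *\<^sub>C snd p)"

instance
  by standard
    (simp_all add: scaleC_prod_def scaleR_prod_def scaleR_scaleC
      scaleC_add_right scaleC_add_left scaleC_scaleC)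

end

instantiation prod :: (complex_inner, complex_inner) complex_inner
begin

definition cinner_prod :: "'a \<times> 'b \<Rightarrow> 'a \<times> 'b \<Rightarrow> complex"
  where "cinner p q = cinner (fst p) (fst q) + cinner (snd p) (snd q)"

instance
proof
  fix p q r :: "'a \<times> 'b" and c :: complex
  show "cinner p q = cnj (cinner q p)"
    by (simp add: cinner_prod_def cinner_commute[of "fst p"] cinner_commute[of "snd p"])
  show "cinner (p + q) r = cinner p r + cinner q r"
    by (simp add: cinner_prod_def cinner_add_left)
  show "cinner (c *\<^sub>C p) q = c * cinner p q"
    by (simp add: cinner_prod_def scaleC_prod_def cinner_scaleC_left algebra_simps)
  show "cinner p p = complex_of_real ((norm p)\<^sup>2)"
    by (simp add: cinner_prod_def cinner_self norm_prod_def del: of_real_power)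
qed

end

instance prod :: (chilbert_space, chilbert_space) chilbert_space ..

instantiation complex :: chilbert_space
begin

definition scaleC_complex :: "complex \<Rightarrow> complex \<Rightarrow> complex"
  where "scaleC_complex = (*)"

definition cinner_complex :: "complex \<Rightarrow> complex \<Rightarrow> complex"
  where "cinner_complex x y = x * cnj y"

instance
  by standard
    (simp_all add: scaleC_complex_def cinner_complex_def algebra_simps scaleR_conv_of_real
      complex_norm_square[symmetric] del: of_real_power)

end

definition orth_compl :: "'a::complex_inner set \<Rightarrow> 'a set"
  where "orth_compl M = {x. \<forall>m\<in>M. cinner x m = 0}"

definition orth_proj :: "'a::complex_inner set \<Rightarrow> 'a \<Rightarrow> 'a"
  where "orth_proj M x = (THE p. p \<in> M \<and> x - p \<in> orth_compl M)"

text \<open>Elements of the quotient of the space by a closed subspace \<open>M\<close> are represented as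
  cosets of \<open>M\<close>, that is, as sets of vectors.\<close>

definition coset :: "'a::complex_inner set \<Rightarrow> 'a \<Rightarrow> 'a set"
  where "coset M x = (\<lambda>m. x + m) ` M"

definition coset_inner :: "'a::complex_inner set \<Rightarrow> 'a set \<Rightarrow> 'a set \<Rightarrow> complex"
  where "coset_inner M A B = (THE c. \<exists>x\<^sub>0\<in>M. \<exists>y\<^sub>0\<in>M. \<exists>x\<^sub>1\<in>orth_compl M. \<exists>y\<^sub>1\<in>orth_compl M.
    A = coset M (x\<^sub>0 + x\<^sub>1) \<and> B = coset M (y\<^sub>0 + y\<^sub>1) \<and> c = cinner x\<^sub>1 y\<^sub>1)"

definition coset_norm :: "'a::complex_inner set \<Rightarrow> 'a set \<Rightarrow> real"
  where "coset_norm M A = sqrt (Re (coset_inner M A A))"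

definition linear_relations :: "('a::complex_vector \<times> 'a) set set"
  where "linear_relations = {T. complex_vector.subspace T}"

abbreviation closed_mul :: "('a::complex_inner \<times> 'a) set \<Rightarrow> 'a set"
  where "closed_mul T \<equiv> closure (T `` {0})"

text \<open>For \<open>x\<close> in the domain of a linear relation \<open>T\<close>, the next two descriptions do not
  depend on the choice of \<open>y \<in> T `` {x}\<close>; outside the domain the values are irrelevant.\<close>

definition op_tilde :: "('a::complex_inner \<times> 'a) set \<Rightarrow> 'a \<Rightarrow> 'a set"
  where "op_tilde T x = (THE A. \<exists>y\<in>T `` {x}. A = coset (closed_mul T) y)"

definition op_hat :: "('a::complex_inner \<times> 'a) set \<Rightarrow> 'a \<Rightarrow> 'a"
  where "op_hat T x = (THE z. \<exists>y\<in>T `` {x}. z = orth_proj (orth_compl (closed_mul T)) y)"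

definition rel_infty :: "('a::complex_inner \<times> 'a) set \<Rightarrow> ('a \<times> 'a) set"
  where "rel_infty T = {(0, g) | g. (0, g) \<in> T}"

definition rel_s :: "('a::complex_inner \<times> 'a) set \<Rightarrow> ('a \<times> 'a) set"
  where "rel_s T = T \<inter> orth_compl (rel_infty T)"

text \<open>The value at \<open>x\<close> of the operator whose graph is \<open>S\<close>.\<close>

definition graph_apply :: "('a \<times> 'b) set \<Rightarrow> 'a \<Rightarrow> 'b"
  where "graph_apply S x = (THE y. (x, y) \<in> S)"

definition rel_norm :: "('a::complex_inner \<times> 'a) set \<Rightarrow> ennreal"
  where "rel_norm T = (SUP x \<in> {x \<in> Domain T. norm x \<le> 1}.
    ennreal (coset_norm (closed_mul T) (op_tilde T x)))"

definition rel_bounded :: "('a::complex_inner \<times> 'a) set \<Rightarrow> bool"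
  where "rel_bounded T \<longleftrightarrow> rel_norm T < \<infinity>"

definition C_tilde :: "('a::complex_inner \<times> 'a) set \<Rightarrow> ennreal"
  where "C_tilde T = (SUP x \<in> {x \<in> Domain T. norm x \<le> 1}.
    ennreal (cmod (coset_inner (closed_mul T) (coset (closed_mul T) x) (op_tilde T x))))"

definition C_hat :: "('a::complex_inner \<times> 'a) set \<Rightarrow> ennreal"
  where "C_hat T = (SUP x \<in> {x \<in> Domain T. norm x \<le> 1}.
    ennreal (cmod (cinner x (op_hat T x))))"

definition C_s :: "('a::complex_inner \<times> 'a) set \<Rightarrow> ennreal"
  where "C_s T = (SUP x \<in> {x \<in> Domain T. norm x \<le> 1}.
    ennreal (cmod (cinner x (graph_apply (rel_s T) x))))"

end

theory Submission
  imports Defs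
begin

text \<open>
  The three quantities \<open>C_tilde T\<close>, \<open>C_hat T\<close> and, for closed \<open>T\<close>, \<open>C_s T\<close> are one and the same:
  the numerical radius of the single operator \<open>S = op_hat T\<close>. Put \<open>M = closed_mul T\<close>. By the
  projection theorem (\<open>orthogonal_decomposition\<close>) the quotient by \<open>M\<close> is isometric to the
  orthogonal complement of \<open>M\<close>, and \<open>op_tilde T\<close> corresponds to \<open>S\<close>; since \<open>S x\<close> is orthogonal
  to \<open>M\<close>, the component of \<open>x\<close> in \<open>M\<close> contributes nothing to \<open>\<langle>x, S x\<rangle>\<close>
  (\<open>coset_norm_op_tilde\<close>, \<open>coset_inner_op_tilde\<close>). If \<open>T\<close> is closed, then \<open>M = T `` {0}\<close>, so
  \<open>S x\<close> is the unique value of \<open>T\<close> at \<open>x\<close> orthogonal to \<open>T `` {0}\<close> (\<open>graph_apply_rel_s\<close>).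

  What remains is a fact about a densely defined linear operator \<open>S\<close> with numerical radius \<open>C\<close>.
  Cauchy--Schwarz gives \<open>C \<le> \<parallel>S\<parallel>\<close>. Conversely, over the complex numbers the quadratic form
  \<open>\<langle>x, S x\<rangle>\<close> determines \<open>\<langle>y, S x\<rangle>\<close> by polarization, and the parallelogram law turns
  \<open>\<bar>\<langle>x, S x\<rangle>\<bar> \<le> C \<parallel>x\<parallel>\<^sup>2\<close> into \<open>\<bar>\<langle>y, S x\<rangle>\<bar> \<le> 2 C\<close> for unit vectors \<open>x\<close>, \<open>y\<close> of the domain.
  As the domain is dense, \<open>\<parallel>S x\<parallel> \<le> 2 C\<close> follows (\<open>norm_le_twice_numerical_radius\<close>).
\<close>

section \<open>Complex inner products\<close>

lemma cinner_zero_left [simp]: "cinner 0 (y :: 'a::complex_inner) = 0"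
  using cinner_scaleC_left[of 0 0 y] by simp

lemma cinner_zero_right [simp]: "cinner (x :: 'a::complex_inner) 0 = 0"
  using cinner_commute[of x 0] by simp

lemma cinner_add_right: "cinner (x :: 'a::complex_inner) (y + z) = cinner x y + cinner x z"
  by (metis cinner_add_left cinner_commute complex_cnj_add)

lemma cinner_scaleC_right: "cinner (x :: 'a::complex_inner) (c *\<^sub>C y) = cnj c * cinner x y"
  by (metis cinner_commute cinner_scaleC_left complex_cnj_mult)

lemma cinner_minus_left: "cinner (- x :: 'a::complex_inner) y = - cinner x y"
  using cinner_scaleC_left[of "-1" x y] by simp

lemma cinner_minus_right: "cinner (x :: 'a::complex_inner) (- y) = - cinner x y"
  using cinner_scaleC_right[of x "-1" y] by simp

lemma cinner_diff_left: "cinner (x - y :: 'a::complex_inner) z = cinner x z - cinner y z"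
  using cinner_add_left[of x "- y" z] by (simp add: cinner_minus_left)

lemma cinner_diff_right: "cinner (x :: 'a::complex_inner) (y - z) = cinner x y - cinner x z"
  using cinner_add_right[of x y "- z"] by (simp add: cinner_minus_right)

lemmas cinner_algebra =
  cinner_add_left cinner_add_right cinner_diff_left cinner_diff_right
  cinner_scaleC_left cinner_scaleC_right

lemma power2_norm_eq_cinner: "(norm (x :: 'a::complex_inner))\<^sup>2 = Re (cinner x x)"
  by (simp add: cinner_self del: of_real_power)

lemma cinner_self_eq_0: "cinner x x = 0 \<longleftrightarrow> x = (0 :: 'a::complex_inner)"
  by (simp add: cinner_self)

lemma norm_scaleC: "norm (c *\<^sub>C x :: 'a::complex_inner) = cmod c * norm x"
proof -
  have "complex_of_real ((norm (c *\<^sub>C x))\<^sup>2) = c * cnj c * cinner x x"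
    by (simp add: cinner_self[symmetric] cinner_algebra mult.assoc del: of_real_power)
  also have "\<dots> = complex_of_real ((cmod c * norm x)\<^sup>2)"
    by (simp only: cinner_self complex_norm_square[symmetric] of_real_mult[symmetric] power_mult_distrib)
  finally have "(norm (c *\<^sub>C x))\<^sup>2 = (cmod c * norm x)\<^sup>2"
    by (simp only: of_real_eq_iff)
  then show ?thesis
    by (simp add: power2_eq_iff_nonneg)
qed

lemma parallelogram_law:
  "(norm (x + y))\<^sup>2 + (norm (x - y))\<^sup>2 = 2 * (norm x)\<^sup>2 + 2 * (norm (y :: 'a::complex_inner))\<^sup>2"
  by (simp add: power2_norm_eq_cinner cinner_algebra)

text \<open>This identity is used twice: nonnegativity of its left side is the Cauchy--Schwarz
  inequality, and if \<open>x\<close> is the residue of a nearest point of a subspace containing \<open>y\<close>, then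
  the left side cannot be smaller than \<open>(norm x)\<^sup>2\<close>, so that \<open>x\<close> is orthogonal to \<open>y\<close>.\<close>

lemma norm_minus_component:
  fixes x y :: "'a::complex_inner"
  assumes "y \<noteq> 0"
  shows "(norm (x - (cinner x y / (norm y)\<^sup>2) *\<^sub>C y))\<^sup>2 =
    (norm x)\<^sup>2 - (cmod (cinner x y))\<^sup>2 / (norm y)\<^sup>2"
proof -
  define n where "n = complex_of_real ((norm y)\<^sup>2)"
  define a where "a = cinner x y"
  have n: "n \<noteq> 0" "cinner y y = n" "cnj n = n" "cinner y x = cnj a" "cinner x y = a"
    using assms by (simp_all add: n_def a_def cinner_self cinner_commute[of y x])
  have "cinner (x - (a / n) *\<^sub>C y) (x - (a / n) *\<^sub>C y) = cinner x x - a * cnj a / n"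
    using n by (simp add: cinner_algebra field_simps)
  then have "complex_of_real ((norm (x - (a / n) *\<^sub>C y))\<^sup>2) =
      complex_of_real ((norm x)\<^sup>2 - (cmod a)\<^sup>2 / (norm y)\<^sup>2)"
    by (simp only: cinner_self n_def complex_norm_square[symmetric] of_real_diff of_real_divide)
  then have "(norm (x - (a / n) *\<^sub>C y))\<^sup>2 = (norm x)\<^sup>2 - (cmod a)\<^sup>2 / (norm y)\<^sup>2"
    by (simp only: of_real_eq_iff)
  then show ?thesis
    by (simp add: a_def n_def)
qed

lemma Cauchy_Schwarz: "cmod (cinner x y) \<le> norm x * norm (y :: 'a::complex_inner)"
proof (cases "y = 0")
  case False
  then have "0 \<le> (norm x)\<^sup>2 - (cmod (cinner x y))\<^sup>2 / (norm y)\<^sup>2"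
    by (metis norm_minus_component zero_le_power2)
  then have "(cmod (cinner x y))\<^sup>2 \<le> (norm x * norm y)\<^sup>2"
    using False by (simp add: field_simps power_mult_distrib)
  then show ?thesis
    by (rule power2_le_imp_le) simp
qed simp

lemma continuous_on_cinner_left: "continuous_on A (\<lambda>x. cinner x (z :: 'a::complex_inner))"
proof -
  have "bounded_linear (\<lambda>x. cinner x z)"
    by (rule bounded_linear_intro[of _ "norm z"])
      (simp_all add: cinner_algebra scaleR_scaleC scaleC_complex_def Cauchy_Schwarz)
  then show ?thesis
    by (rule linear_continuous_on)
qed

lemma continuous_on_scaleC: "continuous_on A (\<lambda>x. c *\<^sub>C (x :: 'a::complex_inner))"
proof -
  have "bounded_linear (\<lambda>x :: 'a. c *\<^sub>C x)"
    by (rule bounded_linear_intro[of _ "cmod c"])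
      (simp_all add: scaleC_add_right scaleR_scaleC scaleC_scaleC mult.commute norm_scaleC)
  then show ?thesis
    by (rule linear_continuous_on)
qed

section \<open>Orthogonal complements and the projection theorem\<close>

lemma subspace_closure:
  fixes M :: "'a::complex_inner set"
  assumes "complex_vector.subspace M"
  shows "complex_vector.subspace (closure M)"
proof (rule complex_vector.subspaceI)
  show "0 \<in> closure M"
    using assms closure_subset complex_vector.subspace_0 by blast
next
  fix x y assume "x \<in> closure M" "y \<in> closure M"
  then obtain f g where "\<And>n. f n \<in> M" "f \<longlonglongrightarrow> x" "\<And>n. g n \<in> M" "g \<longlonglongrightarrow> y"
    by (auto simp: closure_sequential)
  then show "x + y \<in> closure M"
    unfolding closure_sequential
    by (intro exI[of _ "\<lambda>n. f n + g n"])
      (auto intro: tendsto_add complex_vector.subspace_add[OF assms])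
next
  fix c and x assume "x \<in> closure M"
  then have "c *\<^sub>C x \<in> (\<lambda>x. c *\<^sub>C x) ` closure M"
    by blast
  also have "\<dots> \<subseteq> closure M"
    using complex_vector.subspace_scale[OF assms] closure_subset[of M]
    by (intro image_closure_subset continuous_on_scaleC closed_closure) blast
  finally show "c *\<^sub>C x \<in> closure M" .
qed

lemma subspace_orth_compl: "complex_vector.subspace (orth_compl (M :: 'a::complex_inner set))"
  by (rule complex_vector.subspaceI) (auto simp: orth_compl_def cinner_algebra)

lemma orth_compl_Int_self: "x \<in> M \<Longrightarrow> x \<in> orth_compl M \<Longrightarrow> x = (0 :: 'a::complex_inner)"
  using cinner_self_eq_0 by (auto simp: orth_compl_def)

lemma subset_orth_compl_orth_compl: "M \<subseteq> orth_compl (orth_compl (M :: 'a::complex_inner set))"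
  by (auto simp: orth_compl_def) (metis cinner_commute complex_cnj_zero)

text \<open>A minimizing sequence of approximants is Cauchy: by the parallelogram law, two points
  of \<open>M\<close> that are both nearly optimal must be close, since their midpoint also lies in \<open>M\<close>.\<close>

lemma nearest_point_exists:
  fixes M :: "'a::chilbert_space set"
  assumes M: "complex_vector.subspace M" and "closed M"
  obtains p where "p \<in> M" "\<And>m. m \<in> M \<Longrightarrow> norm (x - p) \<le> norm (x - m)"
proof -
  define d where "d = (INF m\<in>M. norm (x - m))"
  have ne: "M \<noteq> {}"
    using complex_vector.subspace_0[OF M] by blast
  have bdd: "bdd_below ((\<lambda>m. norm (x - m)) ` M)"
    by (rule bdd_belowI[of _ 0]) auto
  have le: "d \<le> norm (x - m)" if "m \<in> M" for m
    unfolding d_def using bdd that by (rule cINF_lower)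
  have d0: "0 \<le> d"
    unfolding d_def using ne by (rule cINF_greatest) simp
  have "\<exists>m\<in>M. norm (x - m) < d + inverse (real (Suc n))" for n
    using cINF_less_iff[OF ne bdd, of "d + inverse (real (Suc n))"]
    by (simp add: d_def[symmetric] del: of_nat_Suc)
  then obtain f where f: "\<And>n. f n \<in> M" "\<And>n. norm (x - f n) < d + inverse (real (Suc n))"
    by metis
  have close: "(norm (a - b))\<^sup>2 \<le> 8 * d * e + 4 * e\<^sup>2"
    if "a \<in> M" "b \<in> M" "norm (x - a) \<le> d + e" "norm (x - b) \<le> d + e" for a b e
  proof -
    have "(1/2) *\<^sub>R (a + b) \<in> M"
      unfolding scaleR_scaleC
      by (intro complex_vector.subspace_scale complex_vector.subspace_add M that)
    then have "d \<le> norm (x - (1/2) *\<^sub>R (a + b))"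
      by (rule le)
    also have "x - (1/2) *\<^sub>R (a + b) = (1/2) *\<^sub>R ((x - a) + (x - b))"
      by (simp add: scaleR_right_diff_distrib scaleR_right_distrib algebra_simps
          flip: scaleR_left_distrib)
    finally have "2 * d \<le> norm ((x - a) + (x - b))"
      by simp
    then have "(2 * d)\<^sup>2 \<le> (norm ((x - a) + (x - b)))\<^sup>2"
      using d0 by (intro power_mono) auto
    moreover have "(norm (x - a))\<^sup>2 \<le> (d + e)\<^sup>2" "(norm (x - b))\<^sup>2 \<le> (d + e)\<^sup>2"
      using that by (auto intro: power_mono)
    moreover have "norm ((x - a) - (x - b)) = norm (a - b)"
      by (simp add: norm_minus_commute)
    ultimately show ?thesis
      using parallelogram_law[of "x - a" "x - b"] by (simp add: power2_eq_square algebra_simps)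
  qed
  have lim: "(\<lambda>n. 8 * d * inverse (real (Suc n)) + 4 * (inverse (real (Suc n)))\<^sup>2) \<longlonglongrightarrow> 0"
    by (rule tendsto_eq_intros LIMSEQ_inverse_real_of_nat refl | simp)+
  have "Cauchy f"
  proof (rule CauchyI)
    fix r :: real assume "0 < r"
    then have "\<forall>\<^sub>F n in sequentially.
        8 * d * inverse (real (Suc n)) + 4 * (inverse (real (Suc n)))\<^sup>2 < r\<^sup>2"
      by (intro order_tendstoD(2)[OF lim]) simp
    then obtain N where
      N: "8 * d * inverse (real (Suc N)) + 4 * (inverse (real (Suc N)))\<^sup>2 < r\<^sup>2"
      by (auto simp: eventually_sequentially)
    have "norm (f m - f n) < r" if "N \<le> m" "N \<le> n" for m n
    proof -
      have "norm (x - f k) \<le> d + inverse (real (Suc N))" if "N \<le> k" for k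
      proof -
        have "inverse (real (Suc k)) \<le> inverse (real (Suc N))"
          using that by (intro le_imp_inverse_le) auto
        with f(2)[of k] show ?thesis by linarith
      qed
      then have "(norm (f m - f n))\<^sup>2 < r\<^sup>2"
        using that by (intro le_less_trans[OF close N] f(1))
      then show ?thesis
        by (rule power2_less_imp_less) (use \<open>0 < r\<close> in simp)
    qed
    then show "\<exists>N. \<forall>m\<ge>N. \<forall>n\<ge>N. norm (f m - f n) < r"
      by blast
  qed
  then obtain p where p: "f \<longlonglongrightarrow> p"
    using Cauchy_convergent convergent_def by blast
  show thesis
  proof (rule that)
    show "p \<in> M"
      using \<open>closed M\<close> f(1) p closed_sequentially by blast
    have "norm (x - p) \<le> d"
    proof (rule LIMSEQ_le)
      show "(\<lambda>n. norm (x - f n)) \<longlonglongrightarrow> norm (x - p)"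
        by (intro tendsto_intros p)
      show "(\<lambda>n. d + inverse (real (Suc n))) \<longlonglongrightarrow> d"
        using tendsto_add[OF tendsto_const LIMSEQ_inverse_real_of_nat, of d] by simp
      show "\<exists>N. \<forall>n\<ge>N. norm (x - f n) \<le> d + inverse (real (Suc n))"
        using f(2) less_imp_le by blast
    qed
    then show "norm (x - p) \<le> norm (x - m)" if "m \<in> M" for m
      using le[OF that] by linarith
  qed
qed

theorem orthogonal_decomposition:
  fixes M :: "'a::chilbert_space set"
  assumes M: "complex_vector.subspace M" and "closed M"
  obtains p where "p \<in> M" "x - p \<in> orth_compl M"
proof -
  obtain p where p: "p \<in> M" "\<And>m. m \<in> M \<Longrightarrow> norm (x - p) \<le> norm (x - m)"
    using nearest_point_exists[OF assms, of x] by metis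
  have "cinner (x - p) m = 0" if m: "m \<in> M" for m
  proof (cases "m = 0")
    case False
    define c where "c = cinner (x - p) m / (norm m)\<^sup>2"
    have "p + c *\<^sub>C m \<in> M"
      by (intro complex_vector.subspace_scale complex_vector.subspace_add M m p)
    then have "norm (x - p) \<le> norm ((x - p) - c *\<^sub>C m)"
      using p(2)[of "p + c *\<^sub>C m"] by (simp add: diff_diff_eq)
    then have "(norm (x - p))\<^sup>2 \<le> (norm ((x - p) - c *\<^sub>C m))\<^sup>2"
      by (rule power_mono) simp
    then have "(cmod (cinner (x - p) m))\<^sup>2 / (norm m)\<^sup>2 \<le> 0"
      unfolding c_def norm_minus_component[OF False] by simp
    then show ?thesis
      using False by (simp add: divide_le_0_iff)
  qed simp
  with p(1) show thesis
    by (intro that[of p]) (auto simp: orth_compl_def)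
qed

lemma orth_proj_eqI:
  fixes M :: "'a::complex_inner set"
  assumes M: "complex_vector.subspace M" and "p \<in> M" "x - p \<in> orth_compl M"
  shows "orth_proj M x = p"
  unfolding orth_proj_def
proof (rule the_equality)
  fix q assume q: "q \<in> M \<and> x - q \<in> orth_compl M"
  have "q - p \<in> M"
    using q assms by (simp add: complex_vector.subspace_diff)
  moreover have "(x - p) - (x - q) \<in> orth_compl M"
    by (rule complex_vector.subspace_diff[OF subspace_orth_compl]) (use q assms in auto)
  ultimately have "q - p = 0"
    by (intro orth_compl_Int_self[of _ M]) auto
  then show "q = p" by simp
qed (use assms in simp)

section \<open>The quotient by a closed subspace\<close>

lemma coset_eq_iff:
  fixes M :: "'a::complex_inner set"
  assumes M: "complex_vector.subspace M"
  shows "coset M x = coset M y \<longleftrightarrow> x - y \<in> M"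
proof
  assume "coset M x = coset M y"
  moreover have "x \<in> coset M x"
    unfolding coset_def using complex_vector.subspace_0[OF M] by (auto intro: image_eqI[of _ _ 0])
  ultimately show "x - y \<in> M"
    by (auto simp: coset_def)
next
  assume d: "x - y \<in> M"
  have "x + m \<in> coset M y" if "m \<in> M" for m
    using complex_vector.subspace_add[OF M d that]
    by (auto simp: coset_def intro!: image_eqI[of _ _ "x - y + m"])
  moreover have "y + m \<in> coset M x" if "m \<in> M" for m
    using complex_vector.subspace_diff[OF M that d]
    by (auto simp: coset_def intro!: image_eqI[of _ _ "m - (x - y)"])
  ultimately show "coset M x = coset M y"
    by (auto simp: coset_def)
qed

text \<open>The component of a representative orthogonal to \<open>M\<close> is determined by its coset, so the
  quotient inner product may be computed from any decomposition.\<close>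

lemma coset_inner_eq:
  fixes M :: "'a::complex_inner set"
  assumes M: "complex_vector.subspace M"
    and "x - x\<^sub>1 \<in> M" "x\<^sub>1 \<in> orth_compl M" "y - y\<^sub>1 \<in> M" "y\<^sub>1 \<in> orth_compl M"
  shows "coset_inner M (coset M x) (coset M y) = cinner x\<^sub>1 y\<^sub>1"
proof -
  have uniq: "a\<^sub>1 = b\<^sub>1"
    if "a - a\<^sub>1 \<in> M" "a\<^sub>1 \<in> orth_compl M" "b\<^sub>0 \<in> M" "b\<^sub>1 \<in> orth_compl M"
      "coset M a = coset M (b\<^sub>0 + b\<^sub>1)" for a a\<^sub>1 b\<^sub>0 b\<^sub>1
  proof -
    have "a - (b\<^sub>0 + b\<^sub>1) \<in> M"
      using that coset_eq_iff[OF M] by blast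
    then have "(a - (b\<^sub>0 + b\<^sub>1)) - (a - a\<^sub>1) + b\<^sub>0 \<in> M"
      by (rule complex_vector.subspace_add[OF M complex_vector.subspace_diff[OF M _ that(1)] that(3)])
    moreover have "(a - (b\<^sub>0 + b\<^sub>1)) - (a - a\<^sub>1) + b\<^sub>0 = a\<^sub>1 - b\<^sub>1"
      by (simp add: algebra_simps)
    moreover have "a\<^sub>1 - b\<^sub>1 \<in> orth_compl M"
      using that by (simp add: complex_vector.subspace_diff subspace_orth_compl)
    ultimately show ?thesis
      using orth_compl_Int_self[of "a\<^sub>1 - b\<^sub>1" M] by simp
  qed
  show ?thesis
    unfolding coset_inner_def
  proof (rule the_equality)
    show "\<exists>x\<^sub>0\<in>M. \<exists>y\<^sub>0\<in>M. \<exists>x\<^sub>1'\<in>orth_compl M. \<exists>y\<^sub>1'\<in>orth_compl M.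
        coset M x = coset M (x\<^sub>0 + x\<^sub>1') \<and> coset M y = coset M (y\<^sub>0 + y\<^sub>1') \<and>
        cinner x\<^sub>1 y\<^sub>1 = cinner x\<^sub>1' y\<^sub>1'"
      using assms by (intro bexI[of _ "x - x\<^sub>1"] bexI[of _ "y - y\<^sub>1"] bexI[of _ x\<^sub>1] bexI[of _ y\<^sub>1]) auto
  next
    fix c
    assume "\<exists>x\<^sub>0\<in>M. \<exists>y\<^sub>0\<in>M. \<exists>x\<^sub>1'\<in>orth_compl M. \<exists>y\<^sub>1'\<in>orth_compl M.
        coset M x = coset M (x\<^sub>0 + x\<^sub>1') \<and> coset M y = coset M (y\<^sub>0 + y\<^sub>1') \<and>
        c = cinner x\<^sub>1' y\<^sub>1'"
    then obtain x\<^sub>0 y\<^sub>0 x\<^sub>1' y\<^sub>1' where *: "x\<^sub>0 \<in> M" "y\<^sub>0 \<in> M" "x\<^sub>1' \<in> orth_compl M"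
        "y\<^sub>1' \<in> orth_compl M" "coset M x = coset M (x\<^sub>0 + x\<^sub>1')"
        "coset M y = coset M (y\<^sub>0 + y\<^sub>1')" "c = cinner x\<^sub>1' y\<^sub>1'"
      by blast
    show "c = cinner x\<^sub>1 y\<^sub>1"
      using uniq[OF assms(2,3) *(1,3,5)] uniq[OF assms(4,5) *(2,4,6)] *(7) by simp
  qed
qed

section \<open>The operator part of a linear relation\<close>

lemma linear_relation_add: "T \<in> linear_relations \<Longrightarrow> (x, y) \<in> T \<Longrightarrow> (x', y') \<in> T \<Longrightarrow> (x + x', y + y') \<in> T"
  using complex_vector.subspace_add[of T "(x, y)" "(x', y')"] by (simp add: linear_relations_def)

lemma linear_relation_diff: "T \<in> linear_relations \<Longrightarrow> (x, y) \<in> T \<Longrightarrow> (x', y') \<in> T \<Longrightarrow> (x - x', y - y') \<in> T"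
  using complex_vector.subspace_diff[of T "(x, y)" "(x', y')"] by (simp add: linear_relations_def)

lemma linear_relation_scale: "T \<in> linear_relations \<Longrightarrow> (x, y) \<in> T \<Longrightarrow> (c *\<^sub>C x, c *\<^sub>C y) \<in> T"
  using complex_vector.subspace_scale[of T "(x, y)" c]
  by (simp add: linear_relations_def scaleC_prod_def)

lemma linear_relation_zero: "T \<in> linear_relations \<Longrightarrow> (0, 0) \<in> T"
  using complex_vector.subspace_0[of T] by (simp add: linear_relations_def zero_prod_def)

lemma subspace_Domain: "T \<in> linear_relations \<Longrightarrow> complex_vector.subspace (Domain T)"
  by (rule complex_vector.subspaceI)
    (blast intro: linear_relation_zero linear_relation_add linear_relation_scale)+

lemma subspace_closed_mul:
  assumes T: "T \<in> linear_relations"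
  shows "complex_vector.subspace (closed_mul T)"
proof (intro subspace_closure complex_vector.subspaceI)
  show "0 \<in> T `` {0}"
    using linear_relation_zero[OF T] by blast
  show "x + y \<in> T `` {0}" if "x \<in> T `` {0}" "y \<in> T `` {0}" for x y
    using linear_relation_add[OF T, of 0 x 0 y] that by simp
  show "c *\<^sub>C x \<in> T `` {0}" if "x \<in> T `` {0}" for c x
    using linear_relation_scale[OF T, of 0 x c] that by simp
qed

lemma diff_mem_closed_mul:
  assumes "T \<in> linear_relations" "(x, y) \<in> T" "(x, y') \<in> T"
  shows "y - y' \<in> closed_mul T"
  using linear_relation_diff[OF assms] closure_subset[of "T `` {0}"] by auto

text \<open>Any two values of \<open>T\<close> at \<open>x\<close> differ by an element of \<open>closed_mul T\<close>, so all of them have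
  the same component \<open>p\<close> orthogonal to it.\<close>

lemma op_hat_eqI:
  fixes T :: "('a::complex_inner \<times> 'a) set"
  assumes T: "T \<in> linear_relations"
    and "(x, y) \<in> T" "y - p \<in> closed_mul T" "p \<in> orth_compl (closed_mul T)"
  shows "op_hat T x = p"
proof -
  have proj: "orth_proj (orth_compl (closed_mul T)) z = p" if "(x, z) \<in> T" for z
  proof (rule orth_proj_eqI[OF subspace_orth_compl])
    have "(z - y) + (y - p) \<in> closed_mul T"
      by (rule complex_vector.subspace_add[OF subspace_closed_mul[OF T]
            diff_mem_closed_mul[OF T that assms(2)] assms(3)])
    then show "z - p \<in> orth_compl (orth_compl (closed_mul T))"
      using subset_orth_compl_orth_compl by auto
  qed (use assms in simp)
  show ?thesis
    unfolding op_hat_def using assms(2) proj by (intro the_equality) auto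
qed

lemma op_hat_props:
  fixes T :: "('a::chilbert_space \<times> 'a) set"
  assumes T: "T \<in> linear_relations" and xy: "(x, y) \<in> T"
  shows "y - op_hat T x \<in> closed_mul T" "op_hat T x \<in> orth_compl (closed_mul T)"
proof -
  obtain q where q: "q \<in> closed_mul T" "y - q \<in> orth_compl (closed_mul T)"
    using orthogonal_decomposition[OF subspace_closed_mul[OF T] closed_closure] .
  then have "op_hat T x = y - q"
    by (intro op_hat_eqI[OF T xy]) auto
  with q show "y - op_hat T x \<in> closed_mul T" "op_hat T x \<in> orth_compl (closed_mul T)"
    by auto
qed

lemma op_hat_add:
  fixes T :: "('a::chilbert_space \<times> 'a) set"
  assumes T: "T \<in> linear_relations" and "x \<in> Domain T" "x' \<in> Domain T"
  shows "op_hat T (x + x') = op_hat T x + op_hat T x'"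
proof -
  obtain y y' where y: "(x, y) \<in> T" "(x', y') \<in> T"
    using assms by blast
  show ?thesis
    using complex_vector.subspace_add[OF subspace_closed_mul[OF T]
        op_hat_props(1)[OF T y(1)] op_hat_props(1)[OF T y(2)]]
      complex_vector.subspace_add[OF subspace_orth_compl
        op_hat_props(2)[OF T y(1)] op_hat_props(2)[OF T y(2)]]
    by (intro op_hat_eqI[OF T linear_relation_add[OF T y]]) (auto simp: algebra_simps)
qed

lemma op_hat_scale:
  fixes T :: "('a::chilbert_space \<times> 'a) set"
  assumes T: "T \<in> linear_relations" and "x \<in> Domain T"
  shows "op_hat T (c *\<^sub>C x) = c *\<^sub>C op_hat T x"
proof -
  obtain y where y: "(x, y) \<in> T"
    using assms by blast
  show ?thesis
    using complex_vector.subspace_scale[OF subspace_closed_mul[OF T] op_hat_props(1)[OF T y]]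
      complex_vector.subspace_scale[OF subspace_orth_compl op_hat_props(2)[OF T y]]
    by (intro op_hat_eqI[OF T linear_relation_scale[OF T y]])
      (auto simp: complex_vector.scale_right_diff_distrib)
qed

lemma op_tilde_eq_coset_op_hat:
  fixes T :: "('a::chilbert_space \<times> 'a) set"
  assumes T: "T \<in> linear_relations" and "x \<in> Domain T"
  shows "op_tilde T x = coset (closed_mul T) (op_hat T x)"
proof -
  obtain y where y: "(x, y) \<in> T"
    using assms by blast
  have "coset (closed_mul T) z = coset (closed_mul T) (op_hat T x)" if "(x, z) \<in> T" for z
    using op_hat_props(1)[OF T that] coset_eq_iff[OF subspace_closed_mul[OF T]] by blast
  then show ?thesis
    unfolding op_tilde_def using y by (intro the_equality) auto
qed

text \<open>The canonical map from the orthogonal complement of \<open>closed_mul T\<close> to the quotient is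
  an isometry, and it carries \<open>op_hat T\<close> to \<open>op_tilde T\<close>.\<close>

lemma coset_norm_op_tilde:
  fixes T :: "('a::chilbert_space \<times> 'a) set"
  assumes T: "T \<in> linear_relations" and x: "x \<in> Domain T"
  shows "coset_norm (closed_mul T) (op_tilde T x) = norm (op_hat T x)"
proof -
  obtain y where y: "(x, y) \<in> T"
    using x by blast
  have "coset_inner (closed_mul T) (op_tilde T x) (op_tilde T x) =
      cinner (op_hat T x) (op_hat T x)"
    unfolding op_tilde_eq_coset_op_hat[OF T x]
    using complex_vector.subspace_0[OF subspace_closed_mul[OF T]] op_hat_props(2)[OF T y]
    by (intro coset_inner_eq subspace_closed_mul T) auto
  then show ?thesis
    by (simp add: coset_norm_def power2_norm_eq_cinner[symmetric])
qed

text \<open>Replacing \<open>x\<close> by its component orthogonal to \<open>closed_mul T\<close> does not change its inner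
  product with \<open>op_hat T x\<close>, which lies in that orthogonal complement.\<close>

lemma coset_inner_op_tilde:
  fixes T :: "('a::chilbert_space \<times> 'a) set"
  assumes T: "T \<in> linear_relations" and x: "x \<in> Domain T"
  shows "coset_inner (closed_mul T) (coset (closed_mul T) x) (op_tilde T x) =
    cinner x (op_hat T x)"
proof -
  obtain y where y: "(x, y) \<in> T"
    using x by blast
  obtain q where q: "q \<in> closed_mul T" "x - q \<in> orth_compl (closed_mul T)"
    using orthogonal_decomposition[OF subspace_closed_mul[OF T] closed_closure] .
  have "coset_inner (closed_mul T) (coset (closed_mul T) x) (op_tilde T x) =
      cinner (x - q) (op_hat T x)"
    unfolding op_tilde_eq_coset_op_hat[OF T x]
    using complex_vector.subspace_0[OF subspace_closed_mul[OF T]] op_hat_props(2)[OF T y] q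
    by (intro coset_inner_eq subspace_closed_mul T) auto
  moreover have "cinner q (op_hat T x) = 0"
    using op_hat_props(2)[OF T y] q(1) subset_orth_compl_orth_compl[of "closed_mul T"]
    unfolding orth_compl_def by blast
  ultimately show ?thesis
    by (simp add: cinner_diff_left)
qed

text \<open>If \<open>T\<close> is closed, so is \<open>T `` {0}\<close>; hence discarding from a value \<open>y\<close> of \<open>T\<close> at \<open>x\<close> its
  component in \<open>closed_mul T\<close> leaves another value of \<open>T\<close> at \<open>x\<close>.\<close>

lemma graph_apply_rel_s:
  fixes T :: "('a::chilbert_space \<times> 'a) set"
  assumes T: "T \<in> linear_relations" and "closed T" and x: "x \<in> Domain T"
  shows "graph_apply (rel_s T) x = op_hat T x"
proof -
  obtain y where y: "(x, y) \<in> T"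
    using x by blast
  have "closed (Pair 0 -` T)"
    by (intro continuous_closed_vimage \<open>closed T\<close> continuous_intros)
  moreover have "Pair 0 -` T = T `` {0}"
    by auto
  ultimately have mul: "closed_mul T = T `` {0}"
    by (simp add: closure_closed)
  have s: "(x, z) \<in> rel_s T \<longleftrightarrow> (x, z) \<in> T \<and> z \<in> orth_compl (closed_mul T)" for z
    unfolding mul by (auto simp: rel_s_def rel_infty_def orth_compl_def cinner_prod_def)
  have "(0, y - op_hat T x) \<in> T"
    using op_hat_props(1)[OF T y] unfolding mul by simp
  from linear_relation_diff[OF T y this] have "(x, op_hat T x) \<in> rel_s T"
    using op_hat_props(2)[OF T y] by (simp add: s)
  moreover have "z = op_hat T x" if "(x, z) \<in> rel_s T" for z
    using that complex_vector.subspace_0[OF subspace_closed_mul[OF T]]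
    by (intro op_hat_eqI[OF T, of x z, symmetric]) (auto simp: s)
  ultimately show ?thesis
    unfolding graph_apply_def by (intro the_equality)
qed

section \<open>Numerical radius and norm of a densely defined operator\<close>

text \<open>The polarization identity expresses \<open>4 \<langle>y, S x\<rangle>\<close> through the quadratic form of \<open>S\<close> at
  the four vectors \<open>x \<plusminus> y\<close> and \<open>x \<plusminus> \<i> y\<close>, whose squared norms add up to
  \<open>4 (\<parallel>x\<parallel>\<^sup>2 + \<parallel>y\<parallel>\<^sup>2)\<close> by the parallelogram law.\<close>

lemma sesquilinear_bound_of_quadratic_bound:
  fixes S :: "'a::complex_inner \<Rightarrow> 'a"
  assumes D: "complex_vector.subspace D"
    and add: "\<And>x y. x \<in> D \<Longrightarrow> y \<in> D \<Longrightarrow> S (x + y) = S x + S y"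
    and scale: "\<And>c x. x \<in> D \<Longrightarrow> S (c *\<^sub>C x) = c *\<^sub>C S x"
    and bound: "\<And>x. x \<in> D \<Longrightarrow> cmod (cinner x (S x)) \<le> b * (norm x)\<^sup>2"
    and x: "x \<in> D" and y: "y \<in> D"
  shows "cmod (cinner y (S x)) \<le> b * ((norm x)\<^sup>2 + (norm y)\<^sup>2)"
proof -
  define q where "q u = cinner u (S u)" for u
  have iy: "\<i> *\<^sub>C y \<in> D"
    using y by (rule complex_vector.subspace_scale[OF D])
  have diff: "S (u - v) = S u - S v" if "u \<in> D" "v \<in> D" for u v
    using add[of u "(-1) *\<^sub>C v"] scale[of v "-1"] that complex_vector.subspace_scale[OF D, of v "-1"]
    by simp
  have "4 * cinner y (S x) =
      (q (x + y) - q (x - y)) - \<i> * (q (x + \<i> *\<^sub>C y) - q (x - \<i> *\<^sub>C y))"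
    using x y iy by (simp add: q_def add diff scale cinner_algebra algebra_simps)
  also have "cmod \<dots> \<le> (cmod (q (x + y)) + cmod (q (x - y))) +
      (cmod (q (x + \<i> *\<^sub>C y)) + cmod (q (x - \<i> *\<^sub>C y)))"
    by (rule order_trans[OF norm_triangle_ineq4])
      (auto simp: norm_mult intro!: add_mono norm_triangle_ineq4)
  also have "\<dots> \<le> (b * (norm (x + y))\<^sup>2 + b * (norm (x - y))\<^sup>2) +
      (b * (norm (x + \<i> *\<^sub>C y))\<^sup>2 + b * (norm (x - \<i> *\<^sub>C y))\<^sup>2)"
    unfolding q_def using x y iy
    by (intro add_mono bound complex_vector.subspace_add complex_vector.subspace_diff D)
  also have "\<dots> = b * ((norm (x + y))\<^sup>2 + (norm (x - y))\<^sup>2) +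
      b * ((norm (x + \<i> *\<^sub>C y))\<^sup>2 + (norm (x - \<i> *\<^sub>C y))\<^sup>2)"
    by (simp add: algebra_simps)
  also have "\<dots> = 4 * (b * ((norm x)\<^sup>2 + (norm y)\<^sup>2))"
    unfolding parallelogram_law by (simp add: norm_scaleC algebra_simps)
  finally show ?thesis
    by (simp add: norm_mult)
qed

text \<open>The vector \<open>S x\<close> need not belong to \<open>D\<close>, so it cannot be tested against itself directly;
  but the bound on \<open>\<langle>y, S x\<rangle>\<close> passes to the limit \<open>y \<longlonglongrightarrow> S x\<close> by density.\<close>

lemma norm_le_twice_numerical_radius:
  fixes S :: "'a::complex_inner \<Rightarrow> 'a"
  assumes D: "complex_vector.subspace D" and dense: "closure D = UNIV"
    and add: "\<And>x y. x \<in> D \<Longrightarrow> y \<in> D \<Longrightarrow> S (x + y) = S x + S y"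
    and scale: "\<And>c x. x \<in> D \<Longrightarrow> S (c *\<^sub>C x) = c *\<^sub>C S x"
    and bound: "\<And>x. x \<in> D \<Longrightarrow> norm x \<le> 1 \<Longrightarrow> cmod (cinner x (S x)) \<le> b"
    and "0 \<le> b" and x: "x \<in> D" "norm x \<le> 1"
  shows "norm (S x) \<le> 2 * b"
proof -
  have homog: "cmod (cinner u (S u)) \<le> b * (norm u)\<^sup>2" if u: "u \<in> D" for u
  proof (cases "u = 0")
    case False
    define c where "c = complex_of_real (1 / norm u)"
    have "cmod (cinner (c *\<^sub>C u) (S (c *\<^sub>C u))) \<le> b"
      using u False by (intro bound complex_vector.subspace_scale D) (auto simp: norm_scaleC c_def norm_divide)
    then show ?thesis
      using False u
      by (simp add: scale cinner_algebra norm_mult c_def norm_divide field_simps power2_eq_square)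
  qed simp
  have "cmod (cinner y (S x)) \<le> 2 * b * norm y" if y: "y \<in> D" for y
  proof (cases "y = 0")
    case False
    define c where "c = complex_of_real (1 / norm y)"
    have nc: "norm (c *\<^sub>C y) = 1"
      using False by (simp add: norm_scaleC c_def norm_divide)
    have "cmod (cinner (c *\<^sub>C y) (S x)) \<le> b * ((norm x)\<^sup>2 + (norm (c *\<^sub>C y))\<^sup>2)"
      by (rule sesquilinear_bound_of_quadratic_bound[OF D add scale homog])
        (use x y D in \<open>auto intro: complex_vector.subspace_scale\<close>)
    also have "\<dots> \<le> b * 2"
      using x \<open>0 \<le> b\<close> nc by (intro mult_left_mono) (auto simp: power_le_one)
    finally show ?thesis
      using False by (simp add: cinner_algebra norm_mult c_def norm_divide field_simps)
  qed simp
  then have "D \<subseteq> {y. cmod (cinner y (S x)) \<le> 2 * b * norm y}"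
    by blast
  moreover have "closed {y. cmod (cinner y (S x)) \<le> 2 * b * norm y}"
    by (intro closed_Collect_le continuous_intros continuous_on_cinner_left)
  ultimately have "closure D \<subseteq> {y. cmod (cinner y (S x)) \<le> 2 * b * norm y}"
    by (rule closure_minimal)
  then have "cmod (cinner (S x) (S x)) \<le> 2 * b * norm (S x)"
    using dense by blast
  then have "norm (S x) * norm (S x) \<le> 2 * b * norm (S x)"
    by (simp add: cinner_self power2_eq_square norm_mult)
  then show ?thesis
    using \<open>0 \<le> b\<close> by (cases "S x = 0") auto
qed

section \<open>Boundedness and the quadratic form\<close>

lemma rel_norm_eq:
  fixes T :: "('a::chilbert_space \<times> 'a) set"
  assumes "T \<in> linear_relations"
  shows "rel_norm T = (SUP x \<in> {x \<in> Domain T. norm x \<le> 1}. ennreal (norm (op_hat T x)))"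
  unfolding rel_norm_def by (intro SUP_cong) (auto simp: coset_norm_op_tilde[OF assms])

lemma C_tilde_eq_C_hat:
  fixes T :: "('a::chilbert_space \<times> 'a) set"
  assumes "T \<in> linear_relations"
  shows "C_tilde T = C_hat T"
  unfolding C_tilde_def C_hat_def by (intro SUP_cong) (auto simp: coset_inner_op_tilde[OF assms])

lemma C_s_eq_C_hat:
  fixes T :: "('a::chilbert_space \<times> 'a) set"
  assumes "T \<in> linear_relations" "closed T"
  shows "C_s T = C_hat T"
  unfolding C_s_def C_hat_def by (intro SUP_cong) (auto simp: graph_apply_rel_s[OF assms])

lemma C_hat_le_rel_norm:
  fixes T :: "('a::chilbert_space \<times> 'a) set"
  assumes T: "T \<in> linear_relations"
  shows "C_hat T \<le> rel_norm T"
  unfolding C_hat_def rel_norm_eq[OF T]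
proof (rule SUP_mono)
  fix x assume x: "x \<in> {x \<in> Domain T. norm x \<le> 1}"
  have "cmod (cinner x (op_hat T x)) \<le> norm x * norm (op_hat T x)"
    by (rule Cauchy_Schwarz)
  also have "\<dots> \<le> norm (op_hat T x)"
    using x by (simp add: mult_left_le_one_le)
  finally show "\<exists>z\<in>{x \<in> Domain T. norm x \<le> 1}.
      ennreal (cmod (cinner x (op_hat T x))) \<le> ennreal (norm (op_hat T z))"
    using x ennreal_leI by blast
qed

lemma rel_norm_le_twice_C_hat:
  fixes T :: "('a::chilbert_space \<times> 'a) set"
  assumes T: "T \<in> linear_relations" and dense: "closure (Domain T) = UNIV"
  shows "rel_norm T \<le> 2 * C_hat T"
proof (cases "C_hat T = \<infinity>")
  case True
  then show ?thesis
    by (simp add: ennreal_mult_top)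
next
  case False
  define b where "b = enn2real (C_hat T)"
  have b: "C_hat T = ennreal b"
    using False by (simp add: b_def less_top)
  have "0 \<le> b"
    by (simp add: b_def)
  have form: "cmod (cinner x (op_hat T x)) \<le> b" if "x \<in> Domain T" "norm x \<le> 1" for x
  proof -
    have "ennreal (cmod (cinner x (op_hat T x))) \<le> C_hat T"
      unfolding C_hat_def using that by (intro SUP_upper) auto
    then show ?thesis
      using \<open>0 \<le> b\<close> by (simp add: b)
  qed
  have "norm (op_hat T x) \<le> 2 * b" if "x \<in> Domain T" "norm x \<le> 1" for x
    by (rule norm_le_twice_numerical_radius[where D = "Domain T"])
      (use that dense form \<open>0 \<le> b\<close> in \<open>simp_all add: subspace_Domain[OF T]
        op_hat_add[OF T] op_hat_scale[OF T]\<close>)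
  then have "rel_norm T \<le> ennreal (2 * b)"
    unfolding rel_norm_eq[OF T] by (intro SUP_least ennreal_leI) auto
  also have "\<dots> = 2 * C_hat T"
    using \<open>0 \<le> b\<close> by (simp add: b ennreal_mult)
  finally show ?thesis .
qed

theorem theorem3p1:
  fixes T :: "('a::chilbert_space \<times> 'a) set"
  assumes "T \<in> linear_relations"
    and "closure (Domain T) = UNIV"
  shows "((rel_bounded T \<longleftrightarrow> C_tilde T < \<infinity>) \<and> rel_norm T \<le> 2 * C_tilde T) \<and>
    ((rel_bounded T \<longleftrightarrow> C_hat T < \<infinity>) \<and> rel_norm T \<le> 2 * C_hat T) \<and>
    (closed T \<longrightarrow> (rel_bounded T \<longleftrightarrow> C_s T < \<infinity>) \<and> rel_norm T \<le> 2 * C_s T)"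
proof -
  have upper: "rel_norm T \<le> 2 * C_hat T"
    using assms by (rule rel_norm_le_twice_C_hat)
  have "rel_bounded T \<longleftrightarrow> C_hat T < \<infinity>"
  proof
    assume "rel_bounded T"
    with C_hat_le_rel_norm[OF assms(1)] show "C_hat T < \<infinity>"
      unfolding rel_bounded_def by (rule le_less_trans)
  next
    assume "C_hat T < \<infinity>"
    then have "2 * C_hat T < \<infinity>"
      by (simp add: ennreal_mult_less_top)
    with upper show "rel_bounded T"
      unfolding rel_bounded_def by (rule le_less_trans)
  qed
  with upper show ?thesis
    using C_tilde_eq_C_hat[OF assms(1)] C_s_eq_C_hat[OF assms(1)] by simp
qed

end
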